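(* Let $\mathcal{N}=\{d^{-1}|\phi_j\rangle\langle\phi_j|\}_{j=1}^{d^2}$ be a SIC-POVM in a $d$-dimensional complex Hilbert space $\mathcal{H}$. For each density matrix $\rho$ on $\mathcal{H}$, the min-entropy of the generated probability distribution satisfies $$R_\infty(\mathcal{N}|\rho)\;\ge\;2\ln d-\ln\!\left(1+\sqrt{d-1}\,\sqrt{\mathrm{tr}(\rho^2)\,d-1}\right).$$
   Context: A density matrix on $\mathcal{H}$ is a positive semidefinite operator of trace $1$. A SIC-POVM (symmetric informationally complete POVM) in $d$-dimensional $\mathcal{H}$ is a set of $d^2$ operators $d^{-1}|\phi_j\rangle\langle\phi_j|$, $j=1,\ldots,d^2$, with unit vectors $|\phi_j\rangle$ satisfying $|\langle\phi_j|\phi_k\rangle|^2=\frac{1}{d+1}$ for all $j\ne k$ and the completeness relation $\frac1d\sum_{j=1}^{d^2}|\phi_j\rangle\langle\phi_j|=\mathbf{1}$ (identity operator). The min-entropy of a probability distribution $p=\{p_j\}$ is $R_\infty(p)=-\ln(\max_j p_j)$. $R_\infty(\mathcal{N}|\rho)$ denotes $R_\infty$ of the distribution $p_j(\mathcal{N}|\rho)=d^{-1}\langle\phi_j|\rho|\phi_j\rangle$, $j=1,\ldots,d^2$. *)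

theory Defs
  imports "HOL-Analysis.Analysis"
begin

text \<open>
  The Hilbert space is \<open>complex ^ 'n\<close> with \<open>d = CARD('n)\<close>; operators are matrices
  \<open>complex ^ 'n ^ 'n\<close>.  The library's inner product on this type is the real one, so the sesquilinear
  one, antilinear in the first argument, is introduced here.
\<close>

definition cinner :: "complex ^ 'n \<Rightarrow> complex ^ 'n \<Rightarrow> complex" where
  "cinner x y = (\<Sum>i\<in>UNIV. cnj (x $ i) * y $ i)"

text \<open>The library norm on \<open>complex ^ 'n\<close> is the one induced by \<open>cinner\<close>.\<close>

lemma cinner_self: "cinner x x = complex_of_real ((norm x)\<^sup>2)"
proof -
  have "(norm x)\<^sup>2 = (\<Sum>i\<in>UNIV. (cmod (x $ i))\<^sup>2)"
    by (simp add: norm_vec_def L2_set_def sum_nonneg)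
  then show ?thesis
    by (simp add: cinner_def complex_norm_square mult.commute del: of_real_power)
qed

definition ket_bra :: "complex ^ 'n \<Rightarrow> complex ^ 'n \<Rightarrow> complex ^ 'n ^ 'n" where
  "ket_bra u v = (\<chi> i j. u $ i * cnj (v $ j))"

definition hermitian :: "complex ^ 'n ^ 'n \<Rightarrow> bool" where
  "hermitian A \<longleftrightarrow> (\<forall>i j. A $ i $ j = cnj (A $ j $ i))"

text \<open>For hermitian \<open>A\<close> the number \<open>cinner x (A *v x)\<close> is real, so taking \<open>Re\<close> loses nothing.\<close>

definition pos_semidef :: "complex ^ 'n ^ 'n \<Rightarrow> bool" where
  "pos_semidef A \<longleftrightarrow> hermitian A \<and> (\<forall>x. 0 \<le> Re (cinner x (A *v x)))"

definition density_matrix :: "complex ^ 'n ^ 'n \<Rightarrow> bool" where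
  "density_matrix \<rho> \<longleftrightarrow> pos_semidef \<rho> \<and> trace \<rho> = 1"

text \<open>
  A SIC-POVM is given by its family of vectors \<open>\<phi> 1, \<dots>, \<phi> (d\<^sup>2)\<close>; values of \<open>\<phi>\<close> outside this
  index range are irrelevant.  Its \<open>j\<close>-th operator is \<open>sic_effect \<phi> j\<close>.
\<close>

definition sic_effect :: "(nat \<Rightarrow> complex ^ 'n) \<Rightarrow> nat \<Rightarrow> complex ^ 'n ^ 'n" where
  "sic_effect \<phi> j = (1 / real CARD('n)) *\<^sub>R ket_bra (\<phi> j) (\<phi> j)"

definition sic_povm :: "(nat \<Rightarrow> complex ^ 'n) \<Rightarrow> bool" where
  "sic_povm \<phi> \<longleftrightarrow>
     (\<forall>j\<in>{1..CARD('n)\<^sup>2}. norm (\<phi> j) = 1) \<and>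
     (\<forall>j\<in>{1..CARD('n)\<^sup>2}. \<forall>k\<in>{1..CARD('n)\<^sup>2}. j \<noteq> k \<longrightarrow>
        (cmod (cinner (\<phi> j) (\<phi> k)))\<^sup>2 = 1 / (real CARD('n) + 1)) \<and>
     (\<Sum>j\<in>{1..CARD('n)\<^sup>2}. sic_effect \<phi> j) = mat 1"

definition sic_prob :: "(nat \<Rightarrow> complex ^ 'n) \<Rightarrow> complex ^ 'n ^ 'n \<Rightarrow> nat \<Rightarrow> real" where
  "sic_prob \<phi> \<rho> j = Re (cinner (\<phi> j) (\<rho> *v \<phi> j)) / real CARD('n)"

definition min_entropy :: "'i set \<Rightarrow> ('i \<Rightarrow> real) \<Rightarrow> real" where
  "min_entropy J p = - ln (Max (p ` J))"

definition sic_min_entropy :: "(nat \<Rightarrow> complex ^ 'n) \<Rightarrow> complex ^ 'n ^ 'n \<Rightarrow> real" where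
  "sic_min_entropy \<phi> \<rho> = min_entropy {1..CARD('n)\<^sup>2} (sic_prob \<phi> \<rho>)"

end

theory Submission
  imports Defs
begin

text \<open>
  With respect to the Hilbert-Schmidt inner product, Cauchy-Schwarz applied to the traceless parts
  of \<open>\<rho>\<close> and of a rank-one projection \<open>|\<phi>\<rangle>\<langle>\<phi>|\<close> bounds \<open>d\<langle>\<phi>|\<rho>|\<phi>\<rangle> - 1\<close> by
  \<open>sqrt (d - 1) * sqrt (d * tr (\<rho>\<^sup>2) - 1)\<close>.  The bound holds for every unit vector, hence for the
  largest probability, which completeness makes positive. The library's real inner product on
  \<open>complex ^ 'n ^ 'n\<close> is the real part of the Hilbert-Schmidt one.
\<close>

lemma inner_ket_bra:
  fixes A :: "complex ^ 'n ^ 'n"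
  shows "A \<bullet> ket_bra u v = Re (cinner u (A *v v))"
  by (simp add: inner_vec_def ket_bra_def cinner_def matrix_vector_mult_def inner_complex_def
      sum_distrib_left algebra_simps)

lemma inner_mat_1:
  fixes A :: "complex ^ 'n ^ 'n"
  shows "A \<bullet> mat 1 = Re (trace A)"
proof -
  have "A $ i $ j \<bullet> (mat 1 :: complex ^ 'n ^ 'n) $ i $ j = (if i = j then Re (A $ i $ i) else 0)" for i j
    by (simp add: mat_def inner_complex_def)
  then show ?thesis
    by (simp add: inner_vec_def trace_def)
qed

text \<open>The real inner product conjugates one factor entrywise; hermiticity of \<open>B\<close>
  turns that conjugation into a transposition. With \<open>A = B = \<rho>\<close> this identifies
  \<open>\<rho> \<bullet> \<rho>\<close> with the purity.\<close>

lemma inner_hermitian: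
  fixes A B :: "complex ^ 'n ^ 'n"
  assumes "hermitian B"
  shows "A \<bullet> B = Re (trace (A ** B))"
proof -
  have "A $ i $ j \<bullet> B $ i $ j = Re (A $ i $ j * B $ j $ i)" for i j
    using assms[unfolded hermitian_def, rule_format, of i j] by (simp add: inner_complex_def)
  then show ?thesis
    by (simp add: inner_vec_def trace_def matrix_matrix_mult_def)
qed

lemma ket_bra_inner_mat_1: "ket_bra u u \<bullet> mat 1 = (norm u)\<^sup>2"
  using inner_ket_bra[of "mat 1" u u] by (simp add: inner_commute cinner_self)

lemma ket_bra_mult_vec: "ket_bra u v *v w = cinner v w *s u"
  by (simp add: vec_eq_iff ket_bra_def cinner_def matrix_vector_mult_def sum_distrib_left
      mult_ac)

lemma cinner_scale_right: "cinner u (c *s v) = c * cinner u v"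
  by (simp add: cinner_def sum_distrib_left mult_ac)

lemma ket_bra_inner_self: "ket_bra u u \<bullet> ket_bra u u = (norm u) ^ 4"
  by (simp add: inner_ket_bra ket_bra_mult_vec cinner_scale_right cinner_self
      flip: power_add)

text \<open>Abstract form of the traceless-part argument, with \<open>e\<close> in the role of the
  identity matrix: \<open>d *\<^sub>R x - e\<close> is \<open>d\<close> times the component of
  \<open>x\<close> orthogonal to \<open>e\<close>.\<close>

lemma inner_le_of_inner_unit_eq_1:
  fixes e x y :: "'a::real_inner"
  assumes "e \<bullet> e = d" "d > 0" "x \<bullet> e = 1" "y \<bullet> e = 1"
  shows "d * (x \<bullet> y) \<le> 1 + sqrt (d * (y \<bullet> y) - 1) * sqrt (d * (x \<bullet> x) - 1)"
proof -
  \<comment> \<open>Stated for general \<open>u\<close> and \<open>v\<close> so that it evaluates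
    both the inner product and the two norms in Cauchy-Schwarz.\<close>
  have inner: "(d *\<^sub>R u - e) \<bullet> (d *\<^sub>R v - e) = d * (d * (u \<bullet> v) - 1)"
    if "u \<bullet> e = 1" "v \<bullet> e = 1" for u v
  proof -
    have "e \<bullet> v = 1"
      using that by (simp add: inner_commute)
    then show ?thesis
      using that assms(1) by (simp add: inner_diff_left inner_diff_right right_diff_distrib)
  qed
  have "d * (d * (x \<bullet> y) - 1) \<le> norm (d *\<^sub>R x - e) * norm (d *\<^sub>R y - e)"
    using norm_cauchy_schwarz[of "d *\<^sub>R x - e" "d *\<^sub>R y - e"] assms by (simp only: inner)
  also have "\<dots> = d * (sqrt (d * (y \<bullet> y) - 1) * sqrt (d * (x \<bullet> x) - 1))"
    using assms by (simp add: norm_eq_sqrt_inner inner real_sqrt_mult)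
  finally show ?thesis
    using assms(2) by simp
qed

lemma density_matrix_expectation_le:
  fixes \<rho> :: "complex ^ 'n ^ 'n"
  assumes "density_matrix \<rho>" "norm u = 1"
  shows "real CARD('n) * Re (cinner u (\<rho> *v u)) \<le>
    1 + sqrt (real CARD('n) - 1) * sqrt (Re (trace (\<rho> ** \<rho>)) * real CARD('n) - 1)"
proof -
  have "hermitian \<rho>" "trace \<rho> = 1"
    using assms(1) by (simp_all add: density_matrix_def pos_semidef_def)
  moreover have "(mat 1 :: complex ^ 'n ^ 'n) \<bullet> mat 1 = real CARD('n)"
    by (simp add: inner_mat_1) (simp add: trace_def mat_def)
  ultimately show ?thesis
    using inner_le_of_inner_unit_eq_1[of "mat 1" "real CARD('n)" \<rho> "ket_bra u u"] assms(2)
    by (simp add: inner_mat_1[of \<rho>] inner_hermitian[of \<rho> \<rho>] ket_bra_inner_mat_1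
        ket_bra_inner_self inner_ket_bra[of \<rho>] mult.commute)
qed

lemma sic_prob_eq_inner: "sic_prob \<phi> \<rho> j = \<rho> \<bullet> sic_effect \<phi> j"
  by (simp add: sic_prob_def sic_effect_def inner_ket_bra)

text \<open>By linearity the sum moves onto the effects, where completeness yields
  \<open>mat 1\<close> and hence the trace of \<open>\<rho>\<close>.\<close>

lemma sum_sic_prob:
  fixes \<phi> :: "nat \<Rightarrow> complex ^ 'n"
  assumes "sic_povm \<phi>" "density_matrix \<rho>"
  shows "(\<Sum>j\<in>{1..CARD('n)\<^sup>2}. sic_prob \<phi> \<rho> j) = 1"
  using assms
  by (simp add: sic_prob_eq_inner sic_povm_def density_matrix_def inner_mat_1 flip: inner_sum_right)

theorem proposition8:
  fixes \<phi> :: "nat \<Rightarrow> complex ^ 'n" and \<rho> :: "complex ^ 'n ^ 'n"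
  assumes "sic_povm \<phi>"
    and "density_matrix \<rho>"
  shows "sic_min_entropy \<phi> \<rho> \<ge>
    2 * ln (real CARD('n)) -
    ln (1 + sqrt (real CARD('n) - 1) * sqrt (Re (trace (\<rho> ** \<rho>)) * real CARD('n) - 1))"
proof -
  define d where "d = real CARD('n)"
  define J where "J = {1..CARD('n)\<^sup>2}"
  define b where "b = 1 + sqrt (d - 1) * sqrt (Re (trace (\<rho> ** \<rho>)) * d - 1)"
  define M where "M = Max (sic_prob \<phi> \<rho> ` J)"
  have d: "d > 0"
    by (simp add: d_def)
  have J: "finite J" "J \<noteq> {}"
    by (simp_all add: J_def Suc_le_eq)
  have "\<exists>j\<in>J. sic_prob \<phi> \<rho> j > 0"
    using sum_sic_prob[OF assms] sum_nonpos[of J "sic_prob \<phi> \<rho>"]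
    by (force simp: J_def not_less)
  then have "M > 0"
    using J by (simp add: M_def Max_gr_iff)
  \<comment> \<open>One factor \<open>1 / d\<close> is the weight of the effect, the other comes
    from the expectation bound; together they produce \<open>2 * ln d\<close>.\<close>
  have "sic_prob \<phi> \<rho> j \<le> b / d\<^sup>2" if "j \<in> J" for j
  proof -
    have "norm (\<phi> j) = 1"
      using assms(1) that by (simp add: sic_povm_def J_def)
    from density_matrix_expectation_le[OF assms(2) this] show ?thesis
      using d by (simp add: sic_prob_def b_def d_def field_simps power2_eq_square)
  qed
  then have "M \<le> b / d\<^sup>2"
    using J by (simp add: M_def)
  \<comment> \<open>Positivity of \<open>M\<close> makes \<open>ln\<close> monotone here and also
    forces \<open>b > 0\<close>, so that the logarithm of the quotient splits.\<close>
  with \<open>M > 0\<close> have "b / d\<^sup>2 > 0" "ln M \<le> ln (b / d\<^sup>2)"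
    by simp_all
  then have "ln M \<le> ln b - 2 * ln d"
    using d by (simp add: ln_div ln_realpow zero_less_divide_iff)
  then show ?thesis
    by (simp add: sic_min_entropy_def min_entropy_def M_def J_def b_def d_def)
qed

end
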